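(* Let $f$ and $g$ be arithmetical functions with absolutely convergent Ramanujan expansions $$f(n)=\sum_{r\ge1}\hat f(r)c_r(n),\qquad g(n)=\sum_{s\ge1}\hat g(s)c_s(n)\quad(n\ge1),$$ and suppose there is $\delta>0$ such that $|\hat f(r)|,|\hat g(r)|\ll r^{-1-\delta}$ for all $r\ge1$. Then for positive integers $N$ (with $N\ge 2$ so that $\log N>0$), as $N\to\infty$, $$\sum_{n\le N} f(n)g(n)=\begin{cases} N\sum_{r\ge1}\hat f(r)\hat g(r)\varphi(r)+O\big(N^{1-\delta}(\log N)^{4-2\delta}\big) & \text{if } \delta<1,\\ N\sum_{r\ge1}\hat f(r)\hat g(r)\varphi(r)+O(\log^3 N) & \text{if } \delta=1,\\ N\sum_{r\ge1}\hat f(r)\hat g(r)\varphi(r)+O(1) & \text{if } \delta>1.\end{cases}$$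
   Context: For positive integers $r,n$, the Ramanujan sum is $c_r(n)=\sum_{a\in(\mathbb Z/r\mathbb Z)^*}\zeta_r^{an}$ with $\zeta_r$ a primitive $r$-th root of unity; equivalently $c_r(n)=\sum_{d\mid n,\,d\mid r}\mu(r/d)d$. An arithmetical function $f$ has a Ramanujan expansion with coefficients $\hat f(r)\in\mathbb C$ if $f(n)=\sum_{r\ge1}\hat f(r)c_r(n)$ for every $n\ge1$; it is absolutely convergent if the series converges absolutely for each $n$. $\varphi$ is Euler's totient function. *)

theory Defs
  imports Complex_Main "HOL-Library.Landau_Symbols" "HOL-Number_Theory.Totient"
begin

(* totatives r is the set of residues in {1..r} coprime to r; the sum over a is independent of
   which primitive r-th root of unity is taken, and here it is exp (2 pi i / r). *)
definition ramanujan_sum :: "nat \<Rightarrow> nat \<Rightarrow> complex" where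
  "ramanujan_sum r n = (\<Sum>a\<in>totatives r. cis (2 * pi / real r) ^ (a * n))"

(* Arithmetical functions and coefficient sequences are functions on nat whose value at 0 is
   never used; series over r >= 1 are indexed by Suc r. *)
definition has_ramanujan_expansion :: "(nat \<Rightarrow> complex) \<Rightarrow> (nat \<Rightarrow> complex) \<Rightarrow> bool" where
  "has_ramanujan_expansion f fhat \<longleftrightarrow>
     (\<forall>n\<ge>1. (\<lambda>r. fhat (Suc r) * ramanujan_sum (Suc r) n) sums f n)"

definition has_abs_ramanujan_expansion :: "(nat \<Rightarrow> complex) \<Rightarrow> (nat \<Rightarrow> complex) \<Rightarrow> bool" where
  "has_abs_ramanujan_expansion f fhat \<longleftrightarrow>
     has_ramanujan_expansion f fhat \<and>
     (\<forall>n\<ge>1. summable (\<lambda>r. norm (fhat (Suc r) * ramanujan_sum (Suc r) n)))"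

end

(*
  Put A(d) = sum over k >= 1 of fhat(d k) mu(k), and define B from ghat in the same way. Kluyver's
  formula c_r(n) = sum over d | gcd(r, n) of d mu(r / d) turns the expansions into divisor sums,
  f(n) = sum over d | n of d A(d), where A(d) is O(d^(-1-delta)). Hence
    sum over n <= N of f(n) g(n) = sum over d, e of d A(d) e B(e) floor(N / lcm(d, e)).
  Replacing the floor by N / lcm(d, e) gives the main term: d e / lcm(d, e) = gcd(d, e) is the sum of
  phi(q) over the common divisors q, and A sums to fhat(q) over the multiples of q.
  The error is treated by Rankin's trick. As |floor(x) - x| <= x^sigma for 0 <= sigma <= 1, writing
  d = q a and e = q b with q = gcd(d, e) bounds it by a constant times
    N^sigma zeta(2 delta + sigma) zeta(delta + sigma)^2.
  The choice sigma = 0 settles delta > 1. For delta <= 1, sigma = 1 - delta + 1 / log N gives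
  O(N^(1 - delta) log^2 N), which is stronger than needed since 2 <= 4 - 2 delta.
*)
theory Submission
  imports Defs "HOL-Analysis.Infinite_Sum" "HOL-Analysis.Elementary_Metric_Spaces"
    "HOL-Computational_Algebra.Squarefree"
begin

section \<open>The Moebius function and its sum over divisors\<close>

definition moebius_mu :: "nat \<Rightarrow> int" where
  "moebius_mu n = (if squarefree n then (-1) ^ card (prime_factors n) else 0)"

lemma abs_moebius_mu_le: "\<bar>moebius_mu n\<bar> \<le> 1"
  by (simp add: moebius_mu_def power_abs)

lemma moebius_mu_1 [simp]: "moebius_mu (Suc 0) = 1"
  by (simp add: moebius_mu_def)

lemma moebius_mu_prime_mult:
  assumes "prime p" "\<not> p dvd d" "d > 0"
  shows   "moebius_mu (p * d) = - moebius_mu d"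
proof -
  have cop: "coprime p d" using assms by (simp add: prime_imp_coprime)
  have sq: "squarefree (p * d) \<longleftrightarrow> squarefree d"
    using assms cop squarefree_multD[of p d] squarefree_prime[of p] squarefree_mult_coprime[of p d]
    by blast
  have "prime_factors (p * d) = insert p (prime_factors d)"
    using assms by (auto simp: prime_factors_product prime_prime_factors)
  moreover have "p \<notin> prime_factors d" using assms by (auto simp: prime_factors_dvd)
  ultimately have "card (prime_factors (p * d)) = Suc (card (prime_factors d))" by simp
  thus ?thesis using sq by (simp add: moebius_mu_def)
qed

text \<open>Only squarefree divisors contribute. For a prime \<open>p\<close> dividing
  \<open>n\<close>, multiplication by \<open>p\<close> pairs the squarefree divisors prime to
  \<open>p\<close> with those divisible by \<open>p\<close>, and it flips the sign, so everything
  cancels unless \<open>n = 1\<close>.\<close>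

lemma sum_moebius_mu_divisors:
  assumes "n > 0"
  shows   "(\<Sum>d | d dvd n. moebius_mu d) = (if n = 1 then 1 else 0)"
proof (cases "n = 1")
  case False
  then obtain p where p: "prime p" "p dvd n" using prime_factor_nat by blast
  define S where "S = {d. d dvd n \<and> squarefree d}"
  define S0 where "S0 = {d\<in>S. \<not> p dvd d}"
  define S1 where "S1 = {d\<in>S. p dvd d}"
  have fin: "finite S" using assms by (auto simp: S_def)
  have bij: "bij_betw (\<lambda>d. p * d) S0 S1"
  proof (rule bij_betwI[of _ _ _ "\<lambda>d. d div p"])
    show "(\<lambda>d. p * d) \<in> S0 \<rightarrow> S1"
    proof
      fix d assume d: "d \<in> S0"
      hence cop: "coprime p d" using p by (auto simp: S0_def prime_imp_coprime)
      have "p * d dvd n" using d p cop by (intro divides_mult) (auto simp: S0_def S_def)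
      moreover have "squarefree (p * d)"
        using squarefree_mult_coprime[OF cop squarefree_prime] d p by (simp add: S0_def S_def)
      ultimately show "p * d \<in> S1" by (simp add: S1_def S_def)
    qed
    show "(\<lambda>d. d div p) \<in> S1 \<rightarrow> S0"
    proof
      fix d assume d: "d \<in> S1"
      then obtain k where k: "d = p * k" by (auto simp: S1_def)
      have "p \<noteq> 0" using p by auto
      have "\<not> p dvd k"
      proof
        assume "p dvd k"
        hence "p ^ 2 dvd d" using k by (auto simp: power2_eq_square)
        thus False using d p squarefreeD[of d p] by (auto simp: S1_def S_def)
      qed
      moreover have "k dvd n" "squarefree k"
        using d k by (auto simp: S1_def S_def dest: dvd_mult_right squarefree_multD)
      ultimately show "d div p \<in> S0" using \<open>p \<noteq> 0\<close> k by (simp add: S0_def S_def)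
    qed
  qed (use p in \<open>auto simp: S1_def\<close>)
  have "(\<Sum>d | d dvd n. moebius_mu d) = (\<Sum>d\<in>S. moebius_mu d)"
    using assms by (intro sum.mono_neutral_right) (auto simp: S_def moebius_mu_def)
  also have "\<dots> = (\<Sum>d\<in>S0 \<union> S1. moebius_mu d)"
    by (rule sum.cong) (auto simp: S0_def S1_def)
  also have "\<dots> = (\<Sum>d\<in>S0. moebius_mu d) + (\<Sum>d\<in>S1. moebius_mu d)"
    using fin by (intro sum.union_disjoint) (auto simp: S0_def S1_def)
  also have "(\<Sum>d\<in>S1. moebius_mu d) = (\<Sum>d\<in>S0. moebius_mu (p * d))"
    using sum.reindex_bij_betw[OF bij, of moebius_mu] by simp
  also have "\<dots> = (\<Sum>d\<in>S0. - moebius_mu d)"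
    using p assms by (intro sum.cong refl moebius_mu_prime_mult)
      (auto simp: S0_def S_def intro!: Nat.gr0I)
  finally show ?thesis using False by (simp add: sum_negf)
qed auto

section \<open>Ramanujan sums and Kluyver's formula\<close>

lemma sum_cis_power_eq:
  assumes "m > 0"
  shows   "(\<Sum>a\<in>{0<..m}. cis (2 * pi / real m) ^ (a * n)) = (if m dvd n then of_nat m else 0)"
proof -
  define z where "z = cis (2 * pi / real m) ^ n"
  have z: "z = cis (2 * pi * (real n / real m))"
    by (simp add: z_def DeMoivre mult_ac)
  have zm: "z ^ m = 1"
  proof -
    have "z ^ m = cis (2 * pi * real n)" using assms unfolding z by (simp add: DeMoivre)
    thus ?thesis using cis_multiple_2pi[of "real n"] by (simp add: mult_ac)
  qed
  have "(\<Sum>a\<in>{0<..m}. cis (2 * pi / real m) ^ (a * n)) = (\<Sum>a\<in>{0<..m}. z ^ a)"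
    by (simp add: z_def flip: power_mult) (simp add: mult.commute)
  \<comment> \<open>The exponents run from 1 to \<open>m\<close>, as in \<open>totatives\<close>.
    Letting them start at 0 costs a factor \<open>z\<close>, which is harmless: \<open>z = 1\<close>
    if \<open>m\<close> divides \<open>n\<close>, and otherwise the geometric sum vanishes because
    \<open>z ^ m = 1\<close>.\<close>
  also have "\<dots> = (\<Sum>a<m. z ^ Suc a)"
    by (rule sum.reindex_bij_witness[of _ Suc "\<lambda>a. a - 1"]) auto
  also have "\<dots> = z * (\<Sum>a<m. z ^ a)" by (simp add: sum_distrib_left)
  also have "\<dots> = (if m dvd n then of_nat m else 0)"
  proof (cases "m dvd n")
    case True
    then obtain k where k: "n = m * k" by auto
    have "z = 1" using assms k cis_multiple_2pi[of "real k"] unfolding z by (simp add: mult_ac)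
    thus ?thesis using True by simp
  next
    case False
    have "z \<noteq> 1"
    proof
      assume "z = 1"
      \<comment> \<open>Comparing real parts, the cosine of the angle is 1, so the angle is an
        integer multiple of \<open>2 * pi\<close>.\<close>
      then obtain k :: int where k: "2 * pi * (real n / real m) = of_int (2 * k) * pi"
        unfolding z by (metis Re_complex_of_real cis.sel(1) cos_one_2pi_int mult.commute of_int_mult of_int_numeral of_real_1 mult.assoc)
      hence "real n = real_of_int k * real m" using assms by (simp add: field_simps)
      hence "int n = k * int m" by (metis of_int_eq_iff of_int_mult of_int_of_nat_eq)
      hence "int m dvd int n" by simp
      thus False using False by simp
    qed
    thus ?thesis using False zm by (simp add: geometric_sum)
  qed
  finally show ?thesis .
qed

text \<open>Sort the exponents 1, ..., \<open>m\<close> by their gcd \<open>d\<close> with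
  \<open>m\<close>. Those in one class are \<open>d\<close> times the totatives of
  \<open>m div d\<close>, and the \<open>d\<close>-th power of exp(2 pi i / m) is the standard
  primitive root of order \<open>m div d\<close>; so the class contributes a Ramanujan sum.\<close>

lemma sum_ramanujan_sum_divisors:
  assumes "m > 0"
  shows   "(\<Sum>r | r dvd m. ramanujan_sum r n) = (if m dvd n then of_nat m else 0)"
proof -
  define w where "w = (\<lambda>a. cis (2 * pi / real m) ^ (a * n))"
  define G where "G = (\<lambda>d. {k\<in>{0<..m}. gcd k m = d})"
  have G: "(\<Sum>a\<in>G d. w a) = ramanujan_sum (m div d) n" if d: "d dvd m" for d
  proof -
    have d0: "d > 0" using d assms by (auto intro!: Nat.gr0I)
    have "(\<Sum>a\<in>G d. w a) = (\<Sum>a\<in>totatives (m div d). w (a * d))"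
      unfolding G_def using bij_betw_totatives_gcd_eq[OF d assms]
      by (subst sum.reindex_bij_betw[symmetric]) auto
    also have "\<dots> = (\<Sum>a\<in>totatives (m div d). cis (2 * pi / real (m div d)) ^ (a * n))"
      using d d0 assms by (intro sum.cong refl) (simp add: w_def DeMoivre real_of_nat_div mult_ac)
    finally show ?thesis by (simp add: ramanujan_sum_def)
  qed
  have "(if m dvd n then of_nat m else 0) = (\<Sum>a\<in>{0<..m}. w a)"
    using sum_cis_power_eq[OF assms, of n] by (simp add: w_def)
  also have "{0<..m} = (\<Union>d\<in>{d. d dvd m}. G d)" by (auto simp: G_def)
  also have "sum w \<dots> = (\<Sum>d | d dvd m. sum w (G d))"
    using assms by (intro sum.UNION_disjoint) (auto simp: G_def)
  also have "\<dots> = (\<Sum>d | d dvd m. ramanujan_sum (m div d) n)" by (intro sum.cong refl G) auto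
  also have "\<dots> = (\<Sum>d | d dvd m. ramanujan_sum d n)" using assms
    by (intro sum.reindex_bij_witness[of _ "(div) m" "(div) m"]) (auto elim: dvdE)
  finally show ?thesis ..
qed

text \<open>Moebius inversion of \<open>sum_ramanujan_sum_divisors\<close>, carried out by inserting
  that identity on the right and exchanging the two sums over divisors of \<open>r\<close>.\<close>

theorem ramanujan_sum_kluyver:
  assumes "r > 0"
  shows   "ramanujan_sum r n = (\<Sum>d | d dvd r \<and> d dvd n. of_nat d * of_int (moebius_mu (r div d)))"
proof -
  have fin: "finite {d. d dvd r}" using assms by simp
  have "(\<Sum>d | d dvd r \<and> d dvd n. of_nat d * of_int (moebius_mu (r div d)) :: complex)
      = (\<Sum>d | d dvd r. of_int (moebius_mu (r div d)) * (if d dvd n then of_nat d else 0))"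
    using assms by (intro sum.mono_neutral_cong_left) auto
  also have "\<dots> = (\<Sum>d | d dvd r. of_int (moebius_mu (r div d)) * (\<Sum>s | s dvd d. ramanujan_sum s n))"
    using assms by (intro sum.cong refl, subst sum_ramanujan_sum_divisors) (auto intro!: Nat.gr0I)
  also have "\<dots> = (\<Sum>d | d dvd r. \<Sum>s | s dvd r \<and> s dvd d. of_int (moebius_mu (r div d)) * ramanujan_sum s n)"
    by (intro sum.cong refl) (auto simp: sum_distrib_left intro: dvd_trans intro!: sum.cong)
  also have "\<dots> = (\<Sum>s | s dvd r. \<Sum>d | d dvd r \<and> s dvd d. of_int (moebius_mu (r div d)) * ramanujan_sum s n)"
    using sum.swap_restrict[OF fin fin, of "\<lambda>d s. of_int (moebius_mu (r div d)) * ramanujan_sum s n"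
        "\<lambda>d s. s dvd d"] by simp
  also have "\<dots> = (\<Sum>s | s dvd r. if s = r then ramanujan_sum s n else 0)"
  proof (intro sum.cong refl)
    fix s assume "s \<in> {s. s dvd r}"
    hence s: "s dvd r" by simp
    then obtain t where t: "r = s * t" by auto
    have pos: "s > 0" "t > 0" using assms t by auto
    \<comment> \<open>The complementary divisor \<open>k = r div d\<close> of
      \<open>r = s * t\<close> runs over all divisors of \<open>t\<close>, so the sum detects
      \<open>t = 1\<close>, that is, \<open>s = r\<close>.\<close>
    have "(\<Sum>d | d dvd r \<and> s dvd d. of_int (moebius_mu (r div d)) :: complex)
        = (\<Sum>k | k dvd t. of_int (moebius_mu k))"
      using pos
      by (intro sum.reindex_bij_witness[of _ "\<lambda>k. r div k" "\<lambda>d. r div d"])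
         (auto simp: t elim!: dvdE)
    also have "\<dots> = of_int (\<Sum>k | k dvd t. moebius_mu k)" by simp
    also have "\<dots> = (if t = 1 then 1 else 0)" using sum_moebius_mu_divisors[OF pos(2)] by simp
    finally show "(\<Sum>d | d dvd r \<and> s dvd d. of_int (moebius_mu (r div d)) * ramanujan_sum s n)
        = (if s = r then ramanujan_sum s n else 0)"
      using t pos by (simp flip: sum_distrib_right)
  qed
  also have "\<dots> = ramanujan_sum r n" using assms by (simp add: sum.delta[OF fin])
  finally show ?thesis ..
qed

section \<open>Zeta sums and a double series over least common multiples\<close>

definition zeta_sum :: "real \<Rightarrow> real" where
  "zeta_sum s = (\<Sum>\<^sub>\<infinity>n\<in>{0<..}. real n powr - s)"

text \<open>Where the series diverges, \<open>infsum\<close> has the default value 0, so the sign is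
  right for every \<open>s\<close>.\<close>

lemma zeta_sum_nonneg: "zeta_sum s \<ge> 0"
  unfolding zeta_sum_def by (rule infsum_nonneg) auto

text \<open>The discrete form of comparison with the integral of x^(-s): the mean value theorem for
  x^(1-s) gives an upper bound that telescopes.\<close>

lemma powr_Suc_telescope_le:
  assumes "s > 1" "n > 0"
  shows   "real (Suc n) powr - s \<le> (real n powr (1 - s) - real (Suc n) powr (1 - s)) / (s - 1)"
proof -
  have "\<exists>z>real n. z < real (Suc n) \<and>
      real (Suc n) powr (1 - s) - real n powr (1 - s) = (real (Suc n) - real n) * ((1 - s) * z powr (- s))"
    using assms by (intro MVT2) (auto intro!: derivative_eq_intros)
  then obtain z where z: "z > real n" "z < real (Suc n)"
      "real (Suc n) powr (1 - s) - real n powr (1 - s) = (1 - s) * z powr (- s)" by auto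
  have "real (Suc n) powr - s \<le> z powr - s"
    using z assms by (intro powr_mono2') auto
  also have "\<dots> = (real n powr (1 - s) - real (Suc n) powr (1 - s)) / (s - 1)"
    using z(3) assms by (simp add: field_simps)
  finally show ?thesis .
qed

lemma sum_powr_le:
  assumes "s > 1"
  shows   "(\<Sum>n=1..N. real n powr - s) \<le> s / (s - 1)"
proof -
  \<comment> \<open>The subtracted tail is what lets the telescoping induction close. Starting at
    \<open>Suc N\<close> makes the base case the equality
    \<open>1 = s / (s - 1) - 1 / (s - 1)\<close>.\<close>
  have "(\<Sum>n=1..Suc N. real n powr - s) \<le> s / (s - 1) - real (Suc N) powr (1 - s) / (s - 1)" for N
  proof (induction N)
    case (Suc N)
    have "real (Suc (Suc N)) powr - s
        \<le> (real (Suc N) powr (1 - s) - real (Suc (Suc N)) powr (1 - s)) / (s - 1)"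
      using powr_Suc_telescope_le[OF assms, of "Suc N"] by simp
    thus ?case using Suc by (simp add: diff_divide_distrib)
  qed (use assms in \<open>simp add: diff_divide_distrib[symmetric]\<close>)
  moreover have "real (Suc N) powr (1 - s) / (s - 1) \<ge> 0" for N using assms by simp
  ultimately have "(\<Sum>n=1..Suc N. real n powr - s) \<le> s / (s - 1)" by (smt (verit))
  moreover have "(\<Sum>n=1..N. real n powr - s) \<le> (\<Sum>n=1..Suc N. real n powr - s)" by simp
  ultimately show ?thesis by linarith
qed

lemma sum_powr_le':
  assumes "s > 1" "finite F" "F \<subseteq> {0<..}"
  shows   "(\<Sum>n\<in>F. real n powr - s) \<le> s / (s - 1)"
proof -
  have "F \<subseteq> {1..Max (insert 0 F)}" using assms by (force intro: Max_ge)
  hence "(\<Sum>n\<in>F. real n powr - s) \<le> (\<Sum>n=1..Max (insert 0 F). real n powr - s)"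
    by (intro sum_mono2) auto
  thus ?thesis using sum_powr_le[OF assms(1)] by (rule order_trans)
qed

lemma summable_on_powr:
  assumes "s > 1"
  shows   "(\<lambda>n. real n powr - s) summable_on {0<..}"
  using sum_powr_le'[OF assms] by (intro nonneg_bdd_above_summable_on bdd_aboveI2) auto

text \<open>This records the simple pole at 1: taken at distance 1 / log N from it, the bound is
  what produces the logarithms in the error term.\<close>

lemma zeta_sum_le:
  assumes "s > 1"
  shows   "zeta_sum s \<le> s / (s - 1)"
  unfolding zeta_sum_def using summable_on_powr[OF assms] sum_powr_le'[OF assms]
  by (rule infsum_le_finite_sums)

lemma has_sum_powr: "s > 1 \<Longrightarrow> ((\<lambda>n. real n powr - s) has_sum zeta_sum s) {0<..}"
  by (simp add: zeta_sum_def summable_on_powr)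

text \<open>Nonnegativity lets summability of the iterated sums yield summability over the product
  set.\<close>

lemma has_sum_Times_nonneg:
  fixes f :: "'a \<Rightarrow> real" and g :: "'b \<Rightarrow> real"
  assumes "(f has_sum s) A" "(g has_sum t) B"
    and "\<And>x. x \<in> A \<Longrightarrow> f x \<ge> 0" "\<And>y. y \<in> B \<Longrightarrow> g y \<ge> 0"
  shows   "((\<lambda>(x,y). f x * g y) has_sum s * t) (A \<times> B)"
proof (rule has_sum_SigmaI)
  show "((\<lambda>y. case (x, y) of (x, y) \<Rightarrow> f x * g y) has_sum f x * t) B" for x
    using has_sum_cmult_right[OF assms(2), of "f x"] by simp
  show *: "((\<lambda>x. f x * t) has_sum s * t) A"
    by (rule has_sum_cmult_left[OF assms(1)])
  show "(\<lambda>(x, y). f x * g y) summable_on A \<times> B"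
  proof (rule summable_on_SigmaI)
    show "((\<lambda>y. case (x, y) of (x, y) \<Rightarrow> f x * g y) has_sum f x * t) B" for x
      using has_sum_cmult_right[OF assms(2), of "f x"] by simp
    show "(\<lambda>x. f x * t) summable_on A" using * by (rule has_sum_imp_summable)
  qed (use assms in auto)
qed

lemma has_sum_powr_triple:
  assumes "\<alpha> > 1" "\<beta> > 1"
  shows   "((\<lambda>(q,a,b). real q powr - \<alpha> * (real a powr - \<beta> * real b powr - \<beta>)) has_sum
             zeta_sum \<alpha> * (zeta_sum \<beta> * zeta_sum \<beta>)) ({0<..} \<times> {0<..} \<times> {0<..})"
  using has_sum_Times_nonneg[OF has_sum_powr[OF assms(1)]
          has_sum_Times_nonneg[OF has_sum_powr[OF assms(2)] has_sum_powr[OF assms(2)]]]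
  by (simp add: case_prod_unfold)

text \<open>Write \<open>d = q * a\<close> and \<open>e = q * b\<close> with
  \<open>q = gcd d e\<close>. Then \<open>lcm d e = q * a * b\<close>, and the term splits into
  powers of \<open>q\<close>, \<open>a\<close> and \<open>b\<close> with exponents
  \<open>- (2 * \<delta> + \<sigma>)\<close>, \<open>- (\<delta> + \<sigma>)\<close> and
  \<open>- (\<delta> + \<sigma>)\<close>.\<close>

lemma summable_powr_lcm:
  fixes \<delta> \<sigma> :: real
  assumes "\<delta> + \<sigma> > 1" "\<delta> > 0"
  defines "h \<equiv> (\<lambda>(d,e). (real d * real e) powr - \<delta> * real (lcm d e) powr - \<sigma>)"
  shows   "h summable_on ({0<..} \<times> {0<..})"
    and   "infsum h ({0<..} \<times> {0<..}) \<le> zeta_sum (2 * \<delta> + \<sigma>) * zeta_sum (\<delta> + \<sigma>) ^ 2"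
proof -
  define P where "P = ({0<..} :: nat set)"
  define k where "k = (\<lambda>(q::nat,a::nat,b::nat).
    real q powr - (2 * \<delta> + \<sigma>) * (real a powr - (\<delta> + \<sigma>) * real b powr - (\<delta> + \<sigma>)))"
  define t where "t = (\<lambda>(d::nat,e). (gcd d e, d div gcd d e, e div gcd d e))"
  have k: "(k has_sum zeta_sum (2 * \<delta> + \<sigma>) * (zeta_sum (\<delta> + \<sigma>) * zeta_sum (\<delta> + \<sigma>))) (P \<times> P \<times> P)"
    unfolding k_def P_def using assms by (intro has_sum_powr_triple) auto
  have inj: "inj_on t (P \<times> P)"
    by (rule inj_on_inverseI[of _ "\<lambda>(q,a,b). (q * a, q * b)"]) (auto simp: t_def)
  have sub: "t ` (P \<times> P) \<subseteq> P \<times> P \<times> P"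
    by (auto simp: t_def P_def intro!: Nat.gr0I simp: dvd_div_eq_0_iff)
  have h: "h x = k (t x)" if "x \<in> P \<times> P" for x
  proof -
    obtain d e where x: "x = (d, e)" by (cases x)
    define q where "q = gcd d e"
    obtain a b where ab: "d = q * a" "e = q * b"
      unfolding q_def by (meson dvdE gcd_dvd1 gcd_dvd2)
    have "d > 0" "e > 0" using that by (auto simp: x P_def)
    hence pos: "q > 0" "a > 0" "b > 0" unfolding ab by simp_all
    have "lcm d e * q = d * e" unfolding q_def by (simp add: lcm_mult_gcd)
    hence lcm: "lcm d e = q * a * b" using pos by (simp add: ab)
    have t: "t x = (q, a, b)" using pos by (simp add: t_def x flip: q_def) (simp add: ab)
    have "h x = (real q * real a * (real q * real b)) powr - \<delta> * (real q * real a * real b) powr - \<sigma>"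
      unfolding h_def x prod.case lcm by (simp add: ab)
    also have "\<dots> = (real q powr - \<delta> * real q powr - \<delta> * real q powr - \<sigma>) *
        ((real a powr - \<delta> * real a powr - \<sigma>) * (real b powr - \<delta> * real b powr - \<sigma>))"
      by (simp add: powr_mult)
    also have "\<dots> = k (q, a, b)"
      by (simp add: k_def powr_add[symmetric] algebra_simps)
    finally show ?thesis using t by simp
  qed
  have 1: "k summable_on (t ` (P \<times> P))"
    using has_sum_imp_summable[OF k] sub by (rule summable_on_subset)
  hence "(k \<circ> t) summable_on (P \<times> P)" using inj by (simp add: summable_on_reindex)
  also have "?this \<longleftrightarrow> h summable_on (P \<times> P)" by (intro summable_on_cong) (simp add: h)
  finally show "h summable_on ({0<..} \<times> {0<..})" by (simp add: P_def)
  have "infsum h (P \<times> P) = infsum (k \<circ> t) (P \<times> P)" by (intro infsum_cong) (simp add: h)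
  also have "\<dots> = infsum k (t ` (P \<times> P))" using inj by (simp add: infsum_reindex)
  \<comment> \<open>The image of \<open>t\<close> consists of the triples with \<open>a\<close> and
    \<open>b\<close> coprime. Admitting all triples only adds nonnegative terms, and the sum then
    factors into zeta sums.\<close>
  also have "\<dots> \<le> infsum k (P \<times> P \<times> P)"
    by (rule infsum_mono2[OF 1 has_sum_imp_summable[OF k] sub]) (auto simp: k_def)
  also have "\<dots> = zeta_sum (2 * \<delta> + \<sigma>) * (zeta_sum (\<delta> + \<sigma>) * zeta_sum (\<delta> + \<sigma>))"
    using k by (rule infsumI)
  finally show "infsum h ({0<..} \<times> {0<..}) \<le> zeta_sum (2 * \<delta> + \<sigma>) * zeta_sum (\<delta> + \<sigma>) ^ 2"
    by (simp add: P_def power2_eq_square)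
qed

section \<open>Divisor coefficients of a Ramanujan expansion\<close>

lemma bij_betw_factor_pairs:
  "bij_betw (\<lambda>(m,k). (m * k, k)) ({0<..} \<times> {0<..}) (SIGMA n:{0<..}. {k. k dvd (n::nat)})"
  by (rule bij_betwI[of _ _ _ "\<lambda>(n,k). (n div k, k)"]) (auto elim!: dvdE intro!: Nat.gr0I)

text \<open>For coefficients with the decay assumed below, \<open>d * divisor_coeff fhat d\<close>
  is the Moebius transform of \<open>f\<close> at \<open>d\<close>: its sum over the divisors of
  \<open>n\<close> is \<open>f n\<close>.\<close>

definition divisor_coeff :: "(nat \<Rightarrow> complex) \<Rightarrow> nat \<Rightarrow> complex" where
  "divisor_coeff fhat d = (\<Sum>\<^sub>\<infinity>k\<in>{0<..}. fhat (d * k) * of_int (moebius_mu k))"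

context
  fixes fhat :: "nat \<Rightarrow> complex" and C \<delta> :: real
  assumes pos: "\<delta> > 0"
    and bound: "\<And>r. r > 0 \<Longrightarrow> norm (fhat r) \<le> C * real r powr - (1 + \<delta>)"
begin

text \<open>The majorant separates \<open>d\<close> from \<open>k\<close>: the power of
  \<open>k\<close> gives convergence of the defining series, and the power of \<open>d\<close> gives
  the decay of \<open>divisor_coeff\<close>.\<close>

lemma norm_divisor_coeff_term_le:
  assumes "d > 0" "k > 0"
  shows   "norm (fhat (d * k) * of_int (moebius_mu k))
             \<le> C * real d powr - (1 + \<delta>) * real k powr - (1 + \<delta>)"
proof -
  have "norm (fhat (d * k) * of_int (moebius_mu k)) \<le> norm (fhat (d * k)) * 1"
    unfolding norm_mult using abs_moebius_mu_le[of k]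
    by (intro mult_left_mono) (simp_all add: norm_of_int flip: of_int_abs)
  also have "\<dots> \<le> C * real (d * k) powr - (1 + \<delta>)" using bound[of "d * k"] assms by simp
  also have "\<dots> = C * real d powr - (1 + \<delta>) * real k powr - (1 + \<delta>)"
    unfolding of_nat_mult by (subst powr_mult) (simp_all only: of_nat_0_le_iff mult.assoc)
  finally show ?thesis .
qed

lemma has_sum_divisor_coeff_majorant:
  "d > 0 \<Longrightarrow> ((\<lambda>k. C * real d powr - (1 + \<delta>) * real k powr - (1 + \<delta>)) has_sum
     C * real d powr - (1 + \<delta>) * zeta_sum (1 + \<delta>)) {0<..}"
  using pos by (intro has_sum_cmult_right has_sum_powr) auto

lemma divisor_coeff_abs_summable:
  assumes "d > 0"
  shows   "(\<lambda>k. fhat (d * k) * of_int (moebius_mu k)) abs_summable_on {0<..}"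
  using has_sum_imp_summable[OF has_sum_divisor_coeff_majorant[OF assms]]
  by (rule abs_summable_on_comparison_test')
     (use norm_divisor_coeff_term_le[OF assms] in auto)

lemma divisor_coeff_has_sum:
  assumes "d > 0"
  shows   "((\<lambda>k. fhat (d * k) * of_int (moebius_mu k)) has_sum divisor_coeff fhat d) {0<..}"
  using abs_summable_summable[OF divisor_coeff_abs_summable[OF assms]]
  by (simp add: divisor_coeff_def)

lemma norm_divisor_coeff_le:
  assumes "d > 0"
  shows   "norm (divisor_coeff fhat d) \<le> C * zeta_sum (1 + \<delta>) * real d powr - (1 + \<delta>)"
proof -
  have "norm (divisor_coeff fhat d)
      \<le> (\<Sum>\<^sub>\<infinity>k\<in>{0<..}. norm (fhat (d * k) * of_int (moebius_mu k)))"
    unfolding divisor_coeff_def by (rule norm_infsum_bound[OF divisor_coeff_abs_summable[OF assms]])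
  also have "\<dots> \<le> C * real d powr - (1 + \<delta>) * zeta_sum (1 + \<delta>)"
    by (rule has_sum_mono[OF has_sum_infsum[OF divisor_coeff_abs_summable[OF assms]]
          has_sum_divisor_coeff_majorant[OF assms]])
       (use norm_divisor_coeff_term_le[OF assms] in auto)
  finally show ?thesis by (simp add: mult_ac)
qed

text \<open>This inverts the definition of \<open>divisor_coeff\<close>. The double series of
  \<open>fhat (q * m * k) * moebius_mu k\<close> converges absolutely. Summed over \<open>k\<close>
  first it gives the left side; grouped by \<open>n = m * k\<close> it carries the Moebius sum over
  the divisors of \<open>n\<close>, so only \<open>n = 1\<close> survives.\<close>

lemma sum_divisor_coeff_multiples:
  assumes "q > 0"
  shows   "((\<lambda>m. divisor_coeff fhat (q * m)) has_sum fhat q) {0<..}"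
proof -
  define P where "P = ({0<..} :: nat set)"
  define F where "F = (\<lambda>(m,k). fhat (q * m * k) * of_int (moebius_mu k))"
  define G where "G = (\<lambda>(n,k). fhat (q * n) * of_int (moebius_mu k))"
  have "((\<lambda>(m,k). C * real q powr - (1 + \<delta>) * (real m powr - (1 + \<delta>) * real k powr - (1 + \<delta>))) has_sum
           (C * real q powr - (1 + \<delta>) * (zeta_sum (1 + \<delta>) * zeta_sum (1 + \<delta>)))) (P \<times> P)"
    using has_sum_cmult_right[OF has_sum_Times_nonneg[OF has_sum_powr has_sum_powr],
        of "1 + \<delta>" "1 + \<delta>" "C * real q powr - (1 + \<delta>)"] pos
    by (simp add: case_prod_unfold P_def)
  hence "F abs_summable_on (P \<times> P)"
  proof (rule abs_summable_on_comparison_test'[OF has_sum_imp_summable], clarify)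
    fix m k assume mk: "m \<in> P" "k \<in> P"
    hence "norm (F (m, k)) \<le> C * real (q * m) powr - (1 + \<delta>) * real k powr - (1 + \<delta>)"
      using norm_divisor_coeff_term_le[of "q * m" k] assms by (simp add: F_def P_def)
    also have "\<dots> = C * real q powr - (1 + \<delta>) * (real m powr - (1 + \<delta>) * real k powr - (1 + \<delta>))"
      unfolding of_nat_mult by (subst powr_mult) (simp_all only: of_nat_0_le_iff mult.assoc)
    finally show "norm (F (m, k)) \<le> C * real q powr - (1 + \<delta>) * (real m powr - (1 + \<delta>) * real k powr - (1 + \<delta>))" .
  qed
  then obtain S where S: "(F has_sum S) (P \<times> P)"
    using abs_summable_summable summable_on_def by blast
  have 1: "((\<lambda>m. divisor_coeff fhat (q * m)) has_sum S) P"
    using divisor_coeff_has_sum assms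
    by (intro has_sum_Sigma'[OF S]) (auto simp: F_def P_def)
  \<comment> \<open>From here on the same series is grouped by the product \<open>n = m * k\<close>,
    with \<open>k\<close> running over the finitely many divisors of \<open>n\<close>.\<close>
  have "(F has_sum S) (P \<times> P) \<longleftrightarrow> ((\<lambda>x. G (case x of (m, k) \<Rightarrow> (m * k, k))) has_sum S) (P \<times> P)"
    by (intro has_sum_cong) (auto simp: F_def G_def mult_ac)
  also have "\<dots> \<longleftrightarrow> (G has_sum S) (SIGMA n:P. {k. k dvd n})"
    using bij_betw_factor_pairs unfolding P_def by (rule has_sum_reindex_bij_betw)
  finally have "(G has_sum S) (SIGMA n:P. {k. k dvd n})" using S by simp
  hence "((\<lambda>n. \<Sum>k | k dvd n. G (n, k)) has_sum S) P"
    by (rule has_sum_Sigma') (auto simp: P_def intro!: has_sum_finite)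
  also have "?this \<longleftrightarrow> ((\<lambda>n. if n = 1 then fhat q else 0) has_sum S) P"
  proof (intro has_sum_cong)
    fix n assume "n \<in> P"
    have "(\<Sum>k | k dvd n. G (n, k)) = fhat (q * n) * of_int (\<Sum>k | k dvd n. moebius_mu k)"
      by (simp add: G_def sum_distrib_left)
    thus "(\<Sum>k | k dvd n. G (n, k)) = (if n = 1 then fhat q else 0)"
      using sum_moebius_mu_divisors[of n] \<open>n \<in> P\<close>
      by (simp del: of_int_sum add: P_def split: if_splits)
  qed
  finally have "((\<lambda>n. if n = 1 then fhat q else 0) has_sum S) P" .
  moreover have "((\<lambda>n. if n = 1 then fhat q else 0) has_sum fhat q) P"
    by (rule has_sum_finite_neutralI[of "{1}"]) (auto simp: P_def)
  ultimately have "S = fhat q" by (rule has_sum_unique)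
  thus ?thesis using 1 by (simp add: P_def)
qed

text \<open>Kluyver's formula turns the expansion into a double series over \<open>r\<close> and the
  common divisors \<open>d\<close> of \<open>r\<close> and \<open>n\<close>. Putting
  \<open>r = d * k\<close> and summing over \<open>k\<close> for fixed \<open>d\<close> leaves
  \<open>d * divisor_coeff fhat d\<close>.\<close>

lemma ramanujan_expansion_eq_divisor_sum:
  assumes "has_ramanujan_expansion f fhat" "n > 0"
  shows   "f n = (\<Sum>d | d dvd n. of_nat d * divisor_coeff fhat d)"
proof -
  define P where "P = ({0<..} :: nat set)"
  define D where "D = {d. d dvd n}"
  define F where "F = (\<lambda>(k,d). of_nat d * (fhat (d * k) * of_int (moebius_mu k)))"
  define G where "G = (\<lambda>(r,d). of_nat d * (fhat r * of_int (moebius_mu (r div d))))"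
  have D: "finite D" "D \<subseteq> P" using assms by (auto simp: D_def P_def intro!: Nat.gr0I)
  have inner: "((\<lambda>k. F (k, d)) has_sum of_nat d * divisor_coeff fhat d) P" if "d \<in> D" for d
    using has_sum_cmult_right[OF divisor_coeff_has_sum[of d], of "of_nat d"] that D
    by (auto simp: F_def P_def)
  \<comment> \<open>With the coordinates swapped, the outer index \<open>d\<close> ranges over the
    finite set \<open>D\<close>, so absolute convergence in \<open>k\<close> for each single
    \<open>d\<close> is the point to check.\<close>
  have "(F \<circ> prod.swap) abs_summable_on (D \<times> P)"
    unfolding abs_summable_on_Sigma_iff
  proof (intro conjI ballI)
    fix d assume "d \<in> D"
    hence "d > 0" using D by (auto simp: P_def)
    have "(\<lambda>k. norm (fhat (d * k) * of_int (moebius_mu k))) summable_on P"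
      unfolding P_def by (rule divisor_coeff_abs_summable[OF \<open>d > 0\<close>])
    from summable_on_cmult_right[OF this, of "real d"]
    show "(\<lambda>y. (F \<circ> prod.swap) (d, y)) abs_summable_on P"
      by (simp add: F_def norm_mult)
  qed (use D in auto)
  hence "(F \<circ> prod.swap) summable_on (D \<times> P)" by (rule abs_summable_summable)
  hence "((F \<circ> prod.swap) has_sum (\<Sum>d\<in>D. of_nat d * divisor_coeff fhat d)) (D \<times> P)"
    using inner D by (intro has_sum_SigmaI[where g = "\<lambda>d. of_nat d * divisor_coeff fhat d"]) auto
  hence "(F has_sum (\<Sum>d\<in>D. of_nat d * divisor_coeff fhat d)) (P \<times> D)"
    by (subst has_sum_swap) (simp add: case_prod_unfold prod.swap_def o_def)
  also have "?this \<longleftrightarrow> ((\<lambda>x. G (case x of (k,d) \<Rightarrow> (k * d, d))) has_sum (\<Sum>d\<in>D. of_nat d * divisor_coeff fhat d)) (P \<times> D)"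
    using D by (intro has_sum_cong) (auto simp: F_def G_def mult_ac P_def)
  also have "\<dots> \<longleftrightarrow> (G has_sum (\<Sum>d\<in>D. of_nat d * divisor_coeff fhat d)) (SIGMA r:P. {d. d dvd r \<and> d dvd n})"
  proof (rule has_sum_reindex_bij_betw)
    show "bij_betw (\<lambda>(k,d). (k * d, d)) (P \<times> D) (SIGMA r:P. {d. d dvd r \<and> d dvd n})"
      using assms
      by (intro bij_betwI[of _ _ _ "\<lambda>(n,k). (n div k, k)"])
         (auto simp: P_def D_def elim!: dvdE intro!: Nat.gr0I)
  qed
  finally have "((\<lambda>r. \<Sum>d | d dvd r \<and> d dvd n. G (r, d)) has_sum (\<Sum>d\<in>D. of_nat d * divisor_coeff fhat d)) P"
    by (rule has_sum_Sigma') (use assms in \<open>auto simp: P_def intro!: has_sum_finite\<close>)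
  also have "?this \<longleftrightarrow> ((\<lambda>r. fhat r * ramanujan_sum r n) has_sum (\<Sum>d\<in>D. of_nat d * divisor_coeff fhat d)) P"
    by (intro has_sum_cong) (simp add: P_def G_def ramanujan_sum_kluyver sum_distrib_left mult_ac)
  \<comment> \<open>After the shift to \<open>Suc r\<close> the terms are those of the given
    expansion, and uniqueness of limits identifies the sum with \<open>f n\<close>.\<close>
  also have "\<dots> \<longleftrightarrow> ((\<lambda>r. fhat (Suc r) * ramanujan_sum (Suc r) n) has_sum (\<Sum>d\<in>D. of_nat d * divisor_coeff fhat d)) UNIV"
    by (rule has_sum_reindex_bij_witness[of _ Suc "\<lambda>r. r - 1"]) (auto simp: P_def)
  finally have "(\<lambda>r. fhat (Suc r) * ramanujan_sum (Suc r) n) sums (\<Sum>d\<in>D. of_nat d * divisor_coeff fhat d)"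
    by (rule has_sum_imp_sums)
  moreover have "(\<lambda>r. fhat (Suc r) * ramanujan_sum (Suc r) n) sums f n"
    using assms by (auto simp: has_ramanujan_expansion_def)
  ultimately show ?thesis unfolding D_def by (metis sums_unique2)
qed

end

section \<open>The main term\<close>

lemma summable_on_totient_triples:
  fixes A B :: "nat \<Rightarrow> complex"
  assumes "\<delta> > 0"
    and A: "\<And>d. d > 0 \<Longrightarrow> norm (A d) \<le> CA * real d powr - (1 + \<delta>)"
    and B: "\<And>d. d > 0 \<Longrightarrow> norm (B d) \<le> CB * real d powr - (1 + \<delta>)"
  shows "(\<lambda>(q,a,b). of_nat (totient q) * (A (q * a) * B (q * b))) abs_summable_on
           ({0<..} \<times> {0<..} \<times> {0<..})"
proof -
  define P where "P = ({0<..} :: nat set)"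
  define k where "k = (\<lambda>(q::nat,a::nat,b::nat).
    real q powr - (1 + 2 * \<delta>) * (real a powr - (1 + \<delta>) * real b powr - (1 + \<delta>)))"
  have "k summable_on (P \<times> P \<times> P)"
    unfolding k_def P_def using assms(1)
    by (intro has_sum_imp_summable[OF has_sum_powr_triple]) auto
  hence "(\<lambda>x. CA * CB * k x) summable_on (P \<times> P \<times> P)" by (rule summable_on_cmult_right)
  hence "(\<lambda>(q,a,b). of_nat (totient q) * (A (q * a) * B (q * b))) abs_summable_on (P \<times> P \<times> P)"
  proof (rule abs_summable_on_comparison_test', clarify)
    fix q a b assume P: "q \<in> P" "a \<in> P" "b \<in> P"
    hence pos: "real q > 0" "q * a > 0" "q * b > 0" by (auto simp: P_def)
    have "norm (of_nat (totient q) * (A (q * a) * B (q * b)))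
        = real (totient q) * (norm (A (q * a)) * norm (B (q * b)))" by (simp add: norm_mult)
    \<comment> \<open>Bounding the totient by \<open>q\<close> costs one power of \<open>q\<close>;
      the two coefficients supply \<open>- 2 * (1 + \<delta>)\<close>, so the exponent
      \<open>- (1 + 2 * \<delta>)\<close> remains and the series in \<open>q\<close> still
      converges.\<close>
    also have "\<dots> \<le> real q *
        ((CA * real (q * a) powr - (1 + \<delta>)) * (CB * real (q * b) powr - (1 + \<delta>)))"
      using A[OF pos(2)] B[OF pos(3)] totient_le[of q] order_trans[OF norm_ge_zero A[OF pos(2)]]
      by (intro mult_mono) (auto simp del: of_nat_mult)
    also have "\<dots> = CA * CB * ((real q powr 1 * real q powr - (1 + \<delta>) * real q powr - (1 + \<delta>)) *
        (real a powr - (1 + \<delta>) * real b powr - (1 + \<delta>)))"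
      using pos by (simp add: powr_mult mult_ac)
    also have "\<dots> = CA * CB * k (q, a, b)"
      unfolding powr_add[symmetric] k_def by (simp add: algebra_simps)
    finally show "norm (of_nat (totient q) * (A (q * a) * B (q * b))) \<le> CA * CB * k (q, a, b)" .
  qed
  thus ?thesis by (simp add: P_def)
qed

text \<open>Both series are rearrangements of one absolutely convergent triple series, that of
  \<open>totient q * A (q * m) * B (q * n)\<close>. For fixed \<open>q\<close> it factors into
  \<open>a q\<close> and \<open>b q\<close>; for fixed \<open>d = q * m\<close> and
  \<open>e = q * n\<close>, the totients of the divisors of \<open>gcd d e\<close> add up to
  \<open>gcd d e\<close>.\<close>

lemma has_sum_gcd_eq_totient_sum:
  fixes A B a b :: "nat \<Rightarrow> complex"
  assumes "\<delta> > 0"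
    and A: "\<And>d. d > 0 \<Longrightarrow> norm (A d) \<le> CA * real d powr - (1 + \<delta>)"
    and B: "\<And>d. d > 0 \<Longrightarrow> norm (B d) \<le> CB * real d powr - (1 + \<delta>)"
    and a: "\<And>q. q > 0 \<Longrightarrow> ((\<lambda>m. A (q * m)) has_sum a q) {0<..}"
    and b: "\<And>q. q > 0 \<Longrightarrow> ((\<lambda>m. B (q * m)) has_sum b q) {0<..}"
  shows "\<exists>T. ((\<lambda>(d,e). of_nat (gcd d e) * (A d * B e)) has_sum T) ({0<..} \<times> {0<..}) \<and>
             ((\<lambda>q. of_nat (totient q) * (a q * b q)) has_sum T) {0<..}"
proof -
  define P where "P = ({0<..} :: nat set)"
  define F where "F = (\<lambda>(q,m,n). of_nat (totient q) * (A (q * m) * B (q * n)))"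
  define G where "G = (\<lambda>((d,e),q). of_nat (totient q) * (A d * B e))"
  have absF: "F abs_summable_on (P \<times> P \<times> P)"
    using summable_on_totient_triples[OF assms(1) A B] by (simp add: F_def P_def)
  then obtain T where T: "(F has_sum T) (P \<times> P \<times> P)"
    using abs_summable_summable summable_on_def by blast
  have "((\<lambda>q. of_nat (totient q) * (a q * b q)) has_sum T) P"
  proof (rule has_sum_Sigma'[OF T])
    fix q assume q: "q \<in> P"
    hence q0: "q > 0" by (simp add: P_def)
    have "(\<lambda>y. F (q, y)) abs_summable_on (P \<times> P)"
      using absF q unfolding abs_summable_on_Sigma_iff by blast
    hence "(\<lambda>y. F (q, y)) summable_on (P \<times> P)" by (rule abs_summable_summable)
    moreover have "((\<lambda>n. F (q, (m, n))) has_sum of_nat (totient q) * (A (q * m) * b q)) P" for m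
      unfolding F_def prod.case P_def by (intro has_sum_cmult_right b q0)
    moreover have "((\<lambda>m. of_nat (totient q) * (A (q * m) * b q)) has_sum of_nat (totient q) * (a q * b q)) P"
      unfolding P_def by (intro has_sum_cmult_right has_sum_cmult_left a q0)
    ultimately show "((\<lambda>y. F (q, y)) has_sum of_nat (totient q) * (a q * b q)) (P \<times> P)"
      by (intro has_sum_SigmaI)
  qed
  moreover have "((\<lambda>(d,e). of_nat (gcd d e) * (A d * B e)) has_sum T) (P \<times> P)"
  proof -
    have "(F has_sum T) (P \<times> P \<times> P)
        \<longleftrightarrow> ((\<lambda>x. G (case x of (q,m,n) \<Rightarrow> ((q * m, q * n), q))) has_sum T) (P \<times> P \<times> P)"
      by (intro has_sum_cong) (auto simp: F_def G_def)
    also have "\<dots> \<longleftrightarrow> (G has_sum T) (SIGMA x:P \<times> P. {q. q dvd gcd (fst x) (snd x)})"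
    proof (rule has_sum_reindex_bij_betw)
      show "bij_betw (\<lambda>(q,m,n). ((q * m, q * n), q)) (P \<times> P \<times> P)
              (SIGMA x:P \<times> P. {q. q dvd gcd (fst x) (snd x)})"
        by (rule bij_betwI[of _ _ _ "\<lambda>((d,e),q). (q, d div q, e div q)"])
           (auto simp: P_def elim!: dvdE intro!: Nat.gr0I)
    qed
    finally have "(G has_sum T) (SIGMA x:P \<times> P. {q. q dvd gcd (fst x) (snd x)})" using T by simp
    hence "((\<lambda>x. \<Sum>q | q dvd gcd (fst x) (snd x). G (x, q)) has_sum T) (P \<times> P)"
      by (rule has_sum_Sigma') (auto simp: P_def intro!: has_sum_finite)
    also have "?this \<longleftrightarrow> ?thesis"
    proof (intro has_sum_cong, clarify)
      fix d e
      have "(\<Sum>q | q dvd gcd d e. G ((d, e), q)) = of_nat (\<Sum>q | q dvd gcd d e. totient q) * (A d * B e)"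
        by (simp add: G_def sum_distrib_right)
      thus "(\<Sum>q | q dvd gcd (fst (d, e)) (snd (d, e)). G ((d, e), q)) = of_nat (gcd d e) * (A d * B e)"
        by (simp only: totient_divisor_sum fst_conv snd_conv)
    qed
    finally show ?thesis .
  qed
  ultimately show ?thesis by (auto simp: P_def)
qed

section \<open>Counting common multiples and bounding the error\<close>

lemma card_multiples_le:
  assumes "k > 0"
  shows   "card {n\<in>{1..N}. k dvd n} = N div k"
proof -
  have "bij_betw (\<lambda>i. k * i) {1..N div k} {n\<in>{1..N}. k dvd n}"
    using assms
    by (intro bij_betwI[of _ _ _ "\<lambda>n. n div k"])
       (auto elim!: dvdE simp: less_eq_div_iff_mult_less_eq mult.commute intro!: Suc_leI Nat.gr0I)
  from bij_betw_same_card[OF this] show ?thesis by simp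
qed

text \<open>Both \<open>d\<close> and \<open>e\<close> divide \<open>n\<close> exactly when
  \<open>lcm d e\<close> does, and \<open>N div lcm d e\<close> counts such \<open>n\<close> up to
  \<open>N\<close>.\<close>

lemma sum_divisor_sums_eq:
  fixes u v :: "nat \<Rightarrow> complex"
  shows "(\<Sum>n=1..N. (\<Sum>d | d dvd n. u d) * (\<Sum>e | e dvd n. v e)) =
           (\<Sum>(d,e)\<in>{1..N}\<times>{1..N}. u d * v e * of_nat (N div lcm d e))"
proof -
  \<comment> \<open>Divisors of \<open>n \<le> N\<close> lie in \<open>{1..N}\<close>; this range is
    independent of \<open>n\<close>, so the sums can be exchanged.\<close>
  have ext: "(\<Sum>d | d dvd n. w d) = (\<Sum>d=1..N. if d dvd n then w d else 0)"
    if "n \<in> {1..N}" for n and w :: "nat \<Rightarrow> complex"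
  proof (rule sum.mono_neutral_cong_left)
    show "{d. d dvd n} \<subseteq> {1..N}"
    proof
      fix d assume "d \<in> {d. d dvd n}"
      thus "d \<in> {1..N}"
        using that dvd_pos_nat[of n d] dvd_imp_le[of d n] by (simp add: Suc_le_eq)
    qed
  qed auto
  have "(\<Sum>n=1..N. (\<Sum>d | d dvd n. u d) * (\<Sum>e | e dvd n. v e)) =
        (\<Sum>n=1..N. \<Sum>(d,e)\<in>{1..N}\<times>{1..N}. if lcm d e dvd n then u d * v e else 0)"
    by (intro sum.cong refl) (auto simp: ext sum_product sum.cartesian_product intro!: sum.cong)
  also have "\<dots> = (\<Sum>(d,e)\<in>{1..N}\<times>{1..N}. \<Sum>n=1..N. if lcm d e dvd n then u d * v e else 0)"
    by (subst sum.swap) (simp add: case_prod_unfold)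
  also have "\<dots> = (\<Sum>(d,e)\<in>{1..N}\<times>{1..N}. u d * v e * of_nat (N div lcm d e))"
  proof (intro sum.cong refl, clarify)
    fix d e assume "d \<in> {1..N}" "e \<in> {1..N}"
    hence "lcm d e > 0" by (simp add: lcm_pos_nat)
    have "(\<Sum>n=1..N. if lcm d e dvd n then u d * v e else 0)
        = (\<Sum>n\<in>{n\<in>{1..N}. lcm d e dvd n}. u d * v e)"
      by (rule sum.inter_filter[symmetric]) simp
    thus "(\<Sum>n=1..N. if lcm d e dvd n then u d * v e else 0) = u d * v e * of_nat (N div lcm d e)"
      using card_multiples_le[OF \<open>lcm d e > 0\<close>, of N] by simp
  qed
  finally show ?thesis .
qed

text \<open>With x = N / k: if x < 1, the error is x itself and \<open>\<sigma> \<le> 1\<close>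
  gives x <= x^sigma; if x >= 1, the error is at most 1 and \<open>\<sigma> \<ge> 0\<close> gives 1
  <= x^sigma.\<close>

lemma abs_div_minus_quotient_le_powr:
  fixes N k :: nat
  assumes "k > 0" "0 \<le> \<sigma>" "\<sigma> \<le> 1"
  shows   "\<bar>real (N div k) - real N / real k\<bar> \<le> (real N / real k) powr \<sigma>"
proof (cases "N < k")
  case True
  have "(real N / real k) powr 1 \<le> (real N / real k) powr \<sigma>"
    using True assms by (intro powr_mono') auto
  thus ?thesis using True assms by simp
next
  case False
  have "real N = real (N div k) * real k + real (N mod k)"
    by (metis div_mult_mod_eq of_nat_add of_nat_mult)
  hence "real N / real k = real (N div k) + real (N mod k) / real k"
    using assms by (simp add: field_simps)
  moreover have "real (N mod k) / real k \<le> 1" using assms by simp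
  ultimately have "\<bar>real (N div k) - real N / real k\<bar> \<le> 1" by simp
  also have "1 \<le> (real N / real k) powr \<sigma>" using False assms by (intro ge_one_powr_ge_zero) auto
  finally show ?thesis .
qed

text \<open>Sum and main term are compared term by term as series over all pairs
  \<open>(d, e)\<close>, with weights \<open>N div lcm d e\<close> and \<open>N / lcm d e\<close>.
  The bounds on \<open>d * A d\<close> and \<open>e * B e\<close> combine with the floor estimate to
  the majorant of \<open>summable_powr_lcm\<close>.\<close>

lemma norm_sum_minus_main_term_le:
  fixes A B :: "nat \<Rightarrow> complex"
  assumes "\<delta> > 0" "0 \<le> \<sigma>" "\<sigma> \<le> 1" "\<delta> + \<sigma> > 1"
    and A: "\<And>d. d > 0 \<Longrightarrow> norm (A d) \<le> CA * real d powr - (1 + \<delta>)"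
    and B: "\<And>d. d > 0 \<Longrightarrow> norm (B d) \<le> CB * real d powr - (1 + \<delta>)"
    and T: "((\<lambda>(d,e). of_nat (gcd d e) * (A d * B e)) has_sum T) ({0<..} \<times> {0<..})"
  shows "norm ((\<Sum>n=1..N. (\<Sum>d | d dvd n. of_nat d * A d) * (\<Sum>e | e dvd n. of_nat e * B e))
           - of_nat N * T)
         \<le> CA * CB * real N powr \<sigma> * (zeta_sum (2 * \<delta> + \<sigma>) * zeta_sum (\<delta> + \<sigma>) ^ 2)"
proof -
  define P where "P = ({0<..} :: nat set)"
  define S where "S = (\<Sum>n=1..N. (\<Sum>d | d dvd n. of_nat d * A d) * (\<Sum>e | e dvd n. of_nat e * B e))"
  define F where "F = (\<lambda>(d,e). of_nat d * A d * (of_nat e * B e) * of_nat (N div lcm d e))"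
  define G where "G = (\<lambda>(d,e). of_nat N * (of_nat (gcd d e) * (A d * B e)))"
  define h where "h = (\<lambda>(d::nat,e::nat). (real d * real e) powr - \<delta> * real (lcm d e) powr - \<sigma>)"
  define K where "K = CA * CB * real N powr \<sigma>"
  have h: "h summable_on (P \<times> P)"
      "infsum h (P \<times> P) \<le> zeta_sum (2 * \<delta> + \<sigma>) * zeta_sum (\<delta> + \<sigma>) ^ 2"
    unfolding h_def P_def by (rule summable_powr_lcm; use assms in simp)+
  have CA: "CA \<ge> 0" using order_trans[OF norm_ge_zero A[of 1]] by simp
  have CB: "CB \<ge> 0" using order_trans[OF norm_ge_zero B[of 1]] by simp
  \<comment> \<open>Outside the square \<open>{1..N} \<times> {1..N}\<close> the lcm exceeds
    \<open>N\<close>, so the integer quotient is 0 and the finite sum extends to all pairs.\<close>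
  have "(F has_sum S) (P \<times> P)"
  proof (rule has_sum_finite_neutralI)
    show "S = sum F ({1..N} \<times> {1..N})" unfolding S_def F_def by (rule sum_divisor_sums_eq)
    fix x assume "x \<in> P \<times> P - {1..N} \<times> {1..N}"
    then obtain d e where x: "x = (d, e)" "d > 0" "e > 0" "\<not> (d \<le> N \<and> e \<le> N)"
      by (cases x) (auto simp: P_def)
    have "d \<le> lcm d e" "e \<le> lcm d e" using x by (auto intro!: dvd_imp_le lcm_pos_nat)
    hence "N < lcm d e" using x by auto
    thus "F x = 0" by (simp add: F_def x)
  qed (auto simp: P_def)
  moreover have "(G has_sum of_nat N * T) (P \<times> P)"
    using has_sum_cmult_right[OF T, of "of_nat N"] by (simp add: G_def P_def case_prod_unfold)
  ultimately have diff: "((\<lambda>x. F x - G x) has_sum (S - of_nat N * T)) (P \<times> P)"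
    unfolding diff_conv_add_uminus by (intro has_sum_add has_sum_uminusI)
  have bound: "norm (F x - G x) \<le> K * h x" if "x \<in> P \<times> P" for x
  proof -
    obtain d e where x: "x = (d, e)" by (cases x)
    have de: "d > 0" "e > 0" using that by (auto simp: x P_def)
    hence lcm: "lcm d e > 0" by (simp add: lcm_pos_nat)
    have "gcd d e * lcm d e = d * e" by simp
    hence "real (gcd d e) * real (lcm d e) = real d * real e" unfolding of_nat_mult[symmetric] by simp
    moreover have "real (lcm d e) \<noteq> 0" using lcm by linarith
    ultimately have gcd: "real (gcd d e) = real d * real e / real (lcm d e)"
      by (intro eq_divide_imp)
    have "F x - G x = (of_nat d * A d) * (of_nat e * B e) *
        of_real (real (N div lcm d e) - real N / real (lcm d e))"
    proof -
      have "(of_nat (gcd d e) :: complex) = of_nat d * of_nat e / of_nat (lcm d e)"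
        using arg_cong[OF gcd, of complex_of_real] by simp
      hence "G x = (of_nat d * A d) * (of_nat e * B e) * (of_nat N / of_nat (lcm d e))"
        unfolding G_def x prod.case by (simp only:) simp
      thus ?thesis by (simp add: F_def x right_diff_distrib)
    qed
    hence "norm (F x - G x) = (real d * norm (A d)) * (real e * norm (B e)) *
        \<bar>real (N div lcm d e) - real N / real (lcm d e)\<bar>"
      by (simp only: norm_mult norm_of_nat norm_of_real)
    also have "\<dots> \<le> (real d * (CA * real d powr - (1 + \<delta>))) * (real e * (CB * real e powr - (1 + \<delta>))) *
        (real N / real (lcm d e)) powr \<sigma>"
      using A[OF de(1)] B[OF de(2)] abs_div_minus_quotient_le_powr[OF lcm assms(2,3)] CA CB
      by (intro mult_mono) auto
    \<comment> \<open>The factors \<open>d\<close> and \<open>e\<close> are written as first powers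
      so that \<open>powr_add\<close> can merge them into the exponent
      \<open>- \<delta>\<close>.\<close>
    also have "\<dots> = CA * CB * real N powr \<sigma> * ((real d powr 1 * real d powr - (1 + \<delta>)) *
        (real e powr 1 * real e powr - (1 + \<delta>)) * real (lcm d e) powr - \<sigma>)"
      using de by (simp add: powr_divide powr_minus divide_simps)
    also have "\<dots> = K * h x"
      unfolding powr_add[symmetric] by (simp add: K_def h_def x powr_mult)
    finally show ?thesis .
  qed
  have Kh: "(\<lambda>x. K * h x) summable_on (P \<times> P)" using h(1) by (rule summable_on_cmult_right)
  have "(\<lambda>x. F x - G x) abs_summable_on (P \<times> P)"
    using Kh bound by (rule abs_summable_on_comparison_test')
  hence "norm (S - of_nat N * T) \<le> (\<Sum>\<^sub>\<infinity>x\<in>P\<times>P. norm (F x - G x))"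
    using norm_infsum_bound infsumI[OF diff] by metis
  also have "\<dots> \<le> (\<Sum>\<^sub>\<infinity>x\<in>P\<times>P. K * h x)"
    using Kh bound \<open>(\<lambda>x. F x - G x) abs_summable_on (P \<times> P)\<close> by (intro infsum_mono)
  also have "\<dots> = K * infsum h (P \<times> P)" by (rule infsum_cmult_right')
  also have "\<dots> \<le> K * (zeta_sum (2 * \<delta> + \<sigma>) * zeta_sum (\<delta> + \<sigma>) ^ 2)"
    using h(2) CA CB by (intro mult_left_mono) (auto simp: K_def)
  finally show ?thesis by (simp add: S_def K_def)
qed

section \<open>Choice of the Rankin exponent and conclusion\<close>

lemma eventually_rankin_bound_le:
  fixes \<delta> :: real
  assumes "0 < \<delta>" "\<delta> \<le> 1"
  shows "eventually (\<lambda>N. \<exists>\<sigma>. 0 \<le> \<sigma> \<and> \<sigma> \<le> 1 \<and> \<delta> + \<sigma> > 1 \<and>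
           real N powr \<sigma> * (zeta_sum (2 * \<delta> + \<sigma>) * zeta_sum (\<delta> + \<sigma>) ^ 2)
             \<le> 4 * exp 1 * (1 + 1 / \<delta>) * (real N powr (1 - \<delta>) * ln (real N) ^ 2)) at_top"
proof -
  have lim: "filterlim (\<lambda>N. ln (real N)) at_top sequentially"
    by (intro filterlim_compose[OF ln_at_top] filterlim_real_sequentially)
  \<comment> \<open>The bound \<open>1 / \<delta>\<close> ensures \<open>\<sigma> \<le> 1\<close>
    below; the bound 1 allows \<open>L + 1 \<le> 2 * L\<close>.\<close>
  have ev: "eventually (\<lambda>N. ln (real N) \<ge> max 1 (1 / \<delta>)) sequentially"
    using lim unfolding filterlim_at_top by blast
  show ?thesis using ev eventually_gt_at_top[of 0]
  proof eventually_elim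
    case (elim N)
    define L where "L = ln (real N)"
    have "L \<ge> 1" "L \<ge> 1 / \<delta>" using elim by (auto simp: L_def)
    hence L: "L \<ge> 1" "1 / L \<le> \<delta>" "1 / L > 0" using assms by (auto simp: field_simps)
    \<comment> \<open>Now \<open>\<delta> + \<sigma> = 1 + 1 / L\<close> lies just to the right of
      the pole, at the price of only a factor \<open>exp 1\<close> in
      \<open>N powr \<sigma>\<close>. The argument \<open>2 * \<delta> + \<sigma>\<close> exceeds 1
      by more than \<open>\<delta>\<close>, so its zeta sum stays bounded.\<close>
    define \<sigma> where "\<sigma> = 1 - \<delta> + 1 / L"
    have \<sigma>: "0 \<le> \<sigma>" "\<sigma> \<le> 1" "\<delta> + \<sigma> > 1" using L assms by (auto simp: \<sigma>_def)
    have "real N powr (1 / L) = exp 1" using elim L by (simp add: powr_def L_def)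
    hence N: "real N powr \<sigma> = real N powr (1 - \<delta>) * exp 1" by (simp add: \<sigma>_def powr_add)
    have "zeta_sum (2 * \<delta> + \<sigma>) \<le> (2 * \<delta> + \<sigma>) / (2 * \<delta> + \<sigma> - 1)"
      using \<sigma> assms by (intro zeta_sum_le) auto
    also have "\<dots> = ((\<delta> + 1 / L) + 1) / (\<delta> + 1 / L)" by (simp add: \<sigma>_def)
    also have "\<dots> = 1 + 1 / (\<delta> + 1 / L)"
      by (subst add_divide_distrib, subst divide_self) (use L(3) assms(1) in linarith, rule refl)
    also have "\<dots> \<le> 1 + 1 / \<delta>" using L assms by (simp add: frac_le)
    finally have z1: "zeta_sum (2 * \<delta> + \<sigma>) \<le> 1 + 1 / \<delta>" .
    have "zeta_sum (\<delta> + \<sigma>) \<le> (\<delta> + \<sigma>) / (\<delta> + \<sigma> - 1)"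
      using \<sigma> by (intro zeta_sum_le) auto
    also have "\<dots> = L + 1" using L by (simp add: \<sigma>_def field_simps)
    also have "\<dots> \<le> 2 * L" using L by simp
    finally have "zeta_sum (\<delta> + \<sigma>) ^ 2 \<le> (2 * L) ^ 2" by (rule power_mono) (rule zeta_sum_nonneg)
    hence "real N powr \<sigma> * (zeta_sum (2 * \<delta> + \<sigma>) * zeta_sum (\<delta> + \<sigma>) ^ 2)
        \<le> (real N powr (1 - \<delta>) * exp 1) * ((1 + 1 / \<delta>) * (2 * L) ^ 2)"
      unfolding N using z1 assms by (intro mult_left_mono mult_mono) auto
    also have "\<dots> = 4 * exp 1 * (1 + 1 / \<delta>) * (real N powr (1 - \<delta>) * ln (real N) ^ 2)"
      by (simp add: power_mult_distrib L_def mult_ac)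
    finally show ?case using \<sigma> by blast
  qed
qed

theorem theorem2p1:
  fixes f g fhat ghat :: "nat \<Rightarrow> complex" and \<delta> :: real
  assumes "has_abs_ramanujan_expansion f fhat"
    and "has_abs_ramanujan_expansion g ghat"
    and "\<delta> > 0"
    and "\<exists>C. \<forall>r\<ge>1. norm (fhat r) \<le> C * real r powr (- 1 - \<delta>)"
    and "\<exists>C. \<forall>r\<ge>1. norm (ghat r) \<le> C * real r powr (- 1 - \<delta>)"
  shows
    "let main = (\<lambda>r. fhat (Suc r) * ghat (Suc r) * of_nat (totient (Suc r)));
         err = (\<lambda>N::nat. norm ((\<Sum>n=1..N. f n * g n) - of_nat N * (\<Sum>r. main r)))
     in summable main \<and>
        (\<delta> < 1 \<longrightarrow> err \<in> O(\<lambda>N. real N powr (1 - \<delta>) * ln (real N) powr (4 - 2 * \<delta>))) \<and>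
        (\<delta> = 1 \<longrightarrow> err \<in> O(\<lambda>N. ln (real N) ^ 3)) \<and>
        (\<delta> > 1 \<longrightarrow> err \<in> O(\<lambda>N. 1))"
proof -
  obtain C where fhat: "norm (fhat r) \<le> C * real r powr - (1 + \<delta>)" if "r > 0" for r
    using assms(4) by (auto simp: Suc_le_eq)
  obtain D where ghat: "norm (ghat r) \<le> D * real r powr - (1 + \<delta>)" if "r > 0" for r
    using assms(5) by (auto simp: Suc_le_eq)
  define A B where "A = divisor_coeff fhat" and "B = divisor_coeff ghat"
  define CA CB where "CA = C * zeta_sum (1 + \<delta>)" and "CB = D * zeta_sum (1 + \<delta>)"
  have f: "f n = (\<Sum>d | d dvd n. of_nat d * A d)" if "n > 0" for n
    unfolding A_def using assms(1) that
    by (intro ramanujan_expansion_eq_divisor_sum[OF assms(3) fhat])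
       (auto simp: has_abs_ramanujan_expansion_def)
  have g: "g n = (\<Sum>d | d dvd n. of_nat d * B d)" if "n > 0" for n
    unfolding B_def using assms(2) that
    by (intro ramanujan_expansion_eq_divisor_sum[OF assms(3) ghat])
       (auto simp: has_abs_ramanujan_expansion_def)
  have A: "norm (A d) \<le> CA * real d powr - (1 + \<delta>)" if "d > 0" for d
    unfolding A_def CA_def using norm_divisor_coeff_le[OF assms(3) fhat that] by simp
  have B: "norm (B d) \<le> CB * real d powr - (1 + \<delta>)" if "d > 0" for d
    unfolding B_def CB_def using norm_divisor_coeff_le[OF assms(3) ghat that] by simp
  \<comment> \<open>The same \<open>T\<close> is the gcd-weighted double series met in the error
    bound and the totient series of the main term.\<close>
  obtain T where T: "((\<lambda>(d,e). of_nat (gcd d e) * (A d * B e)) has_sum T) ({0<..} \<times> {0<..})"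
      "((\<lambda>q. of_nat (totient q) * (fhat q * ghat q)) has_sum T) {0<..}"
    using has_sum_gcd_eq_totient_sum[OF assms(3) A B
        sum_divisor_coeff_multiples[OF assms(3) fhat, folded A_def]
        sum_divisor_coeff_multiples[OF assms(3) ghat, folded B_def]] by blast
  define main where "main = (\<lambda>r. fhat (Suc r) * ghat (Suc r) * of_nat (totient (Suc r)))"
  define err where "err = (\<lambda>N::nat. norm ((\<Sum>n=1..N. f n * g n) - of_nat N * (\<Sum>r. main r)))"
  have "((\<lambda>q. of_nat (totient q) * (fhat q * ghat q)) has_sum T) {0<..} \<longleftrightarrow> (main has_sum T) UNIV"
    by (rule has_sum_reindex_bij_witness[of _ Suc "\<lambda>r. r - 1"]) (auto simp: main_def)
  hence main: "main sums T" using T(2) by (simp add: has_sum_imp_sums)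
  \<comment> \<open>The constant does not involve \<open>\<sigma>\<close> or \<open>N\<close>, so
    \<open>\<sigma>\<close> may be chosen depending on \<open>N\<close>.\<close>
  have err: "err N \<le> CA * CB * (real N powr \<sigma> * (zeta_sum (2 * \<delta> + \<sigma>) * zeta_sum (\<delta> + \<sigma>) ^ 2))"
    if "0 \<le> \<sigma>" "\<sigma> \<le> 1" "\<delta> + \<sigma> > 1" for N \<sigma>
    using norm_sum_minus_main_term_le[OF assms(3) that A B T(1), of N] main
    by (simp add: err_def f g sums_iff mult.assoc)
  have K: "CA * CB \<ge> 0"
    using order_trans[OF norm_ge_zero A[of 1]] order_trans[OF norm_ge_zero B[of 1]] by simp
  have err_le_1: "err \<in> O(\<lambda>N. real N powr (1 - \<delta>) * ln (real N) ^ 2)" if "\<delta> \<le> 1"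
  proof (rule bigoI)
    show "eventually (\<lambda>N. norm (err N) \<le> CA * CB * (4 * exp 1 * (1 + 1 / \<delta>)) *
            norm (real N powr (1 - \<delta>) * ln (real N) ^ 2)) at_top"
      using eventually_rankin_bound_le[OF assms(3) that]
    proof eventually_elim
      case (elim N)
      then obtain \<sigma> where \<sigma>: "0 \<le> \<sigma>" "\<sigma> \<le> 1" "\<delta> + \<sigma> > 1"
        "real N powr \<sigma> * (zeta_sum (2 * \<delta> + \<sigma>) * zeta_sum (\<delta> + \<sigma>) ^ 2)
           \<le> 4 * exp 1 * (1 + 1 / \<delta>) * (real N powr (1 - \<delta>) * ln (real N) ^ 2)" by blast
      have "norm (err N) = err N" by (simp add: err_def)
      also have "\<dots> \<le> CA * CB * (4 * exp 1 * (1 + 1 / \<delta>) * (real N powr (1 - \<delta>) * ln (real N) ^ 2))"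
        using err[OF \<sigma>(1-3)] mult_left_mono[OF \<sigma>(4) K] by (rule order_trans)
      finally show ?case by (simp add: mult.assoc)
    qed
  qed
  have ln_ge_1: "eventually (\<lambda>N. ln (real N) \<ge> 1) sequentially"
    using filterlim_compose[OF ln_at_top filterlim_real_sequentially] by (simp add: filterlim_at_top)
  have "err \<in> O(\<lambda>N. real N powr (1 - \<delta>) * ln (real N) powr (4 - 2 * \<delta>))" if "\<delta> < 1"
  proof (rule landau_o.big_trans[OF err_le_1])
    show "(\<lambda>N. real N powr (1 - \<delta>) * ln (real N) ^ 2)
            \<in> O(\<lambda>N. real N powr (1 - \<delta>) * ln (real N) powr (4 - 2 * \<delta>))"
    proof (rule bigoI[where c = 1], use ln_ge_1 in eventually_elim)
      case (elim N)
      have "ln (real N) ^ 2 = ln (real N) powr 2" using elim by (simp add: powr_numeral)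
      \<comment> \<open>Here \<open>2 \<le> 4 - 2 * \<delta>\<close> because
        \<open>\<delta> < 1\<close>, and the base is at least 1.\<close>
      also have "\<dots> \<le> ln (real N) powr (4 - 2 * \<delta>)" using elim that by (intro powr_mono) auto
      finally show ?case by (simp add: abs_mult mult_left_mono)
    qed
  qed (use that in simp)
  moreover have "err \<in> O(\<lambda>N. ln (real N) ^ 3)" if "\<delta> = 1"
  proof (rule landau_o.big_trans[OF err_le_1])
    show "(\<lambda>N. real N powr (1 - \<delta>) * ln (real N) ^ 2) \<in> O(\<lambda>N. ln (real N) ^ 3)"
    proof (rule bigoI[where c = 1], use ln_ge_1 eventually_gt_at_top[of 0] in eventually_elim)
      case (elim N)
      have "ln (real N) ^ 2 \<le> ln (real N) ^ 3" using elim by (intro power_increasing) auto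
      thus ?case using elim that by simp
    qed
  qed (use that in simp)
  moreover have "err \<in> O(\<lambda>N. 1)" if "\<delta> > 1"
  proof (rule bigoI, use eventually_gt_at_top[of 0] in eventually_elim)
    case (elim N)
    \<comment> \<open>For \<open>\<delta> > 1\<close> the choice \<open>\<sigma> = 0\<close> is
      admissible, and \<open>N powr 0 = 1\<close> once \<open>N > 0\<close>.\<close>
    thus "norm (err N) \<le> CA * CB * (zeta_sum (2 * \<delta>) * zeta_sum \<delta> ^ 2) * norm (1 :: real)"
      using err[of 0 N] that by (simp add: err_def)
  qed
  ultimately show ?thesis
    unfolding Let_def main_def[symmetric] err_def[symmetric] using main by (simp add: sums_iff)
qed

end
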